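(* For every $\epsilon$ with $0<\epsilon<2$ there is an $N_\epsilon$ such that for each Player 2 strategy $g$ in the binary sequence game, there is a $g$-computable sequence $e_1e_3e_5\dots$ of Player 1 moves such that, when it is played against $g$, any two identical blocks of length $n>N_\epsilon$ in the resulting sequence $a_1a_2a_3\dots$ have distance at least $f(n)=(2-\epsilon)^{n/2}$. That is, if $k<\ell$, $n>N_\epsilon$ and $a_{k+s}=a_{\ell+s}$ for all $0\le s<n$, then $\ell-k\ge(2-\epsilon)^{n/2}$.
   Context: In the binary sequence game two players alternately choose bits, generating an infinite binary sequence $a_1a_2a_3a_4\dots=e_1d_2e_3d_4\dots$; Player 1 chooses the odd-indexed bits $e_{2i+1}$ and Player 2 the even-indexed bits $d_{2i}$, each with knowledge of all preceding bits but not future bits. A Player 2 strategy is a function $g$ from finite sequences of Player 1 moves to $\{0,1\}$; playing $e_1e_3e_5\dots$ against $g$ means $d_{2i}=g(e_1,e_3,\dots,e_{2i-1})$ for all $i\ge1$. "$g$-computable" means computable relative to the oracle $g$. *)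

theory Defs
  imports Complex_Main
begin

section \<open>Relative computability\<close>

text \<open>
  Codes for partial recursive functions relative to a total function \<open>h\<close>: Kleene's schemes
  together with a scheme \<open>Query\<close> that evaluates \<open>h\<close>. The relation \<open>computes h c xs y\<close> says that
  the code \<open>c\<close>, run relative to \<open>h\<close> on the argument list \<open>xs\<close>, halts with value \<open>y\<close>. Arities
  are not part of the syntax: where a scheme does not fit the length of the argument list, there
  is no value, and \<open>Zero\<close> and \<open>Proj\<close> accept lists of every (sufficient) length.
\<close>

datatype code =
    Zero
  | Succ
  | Proj nat
  | Query
  | Comp code "code list"
  | PrimRec code code
  | Mu code

inductive computes :: "(nat \<Rightarrow> nat) \<Rightarrow> code \<Rightarrow> nat list \<Rightarrow> nat \<Rightarrow> bool"
  for h :: "nat \<Rightarrow> nat" where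
  Zero: "computes h Zero xs 0"
| Succ: "computes h Succ [x] (Suc x)"
| Proj: "i < length xs \<Longrightarrow> computes h (Proj i) xs (xs ! i)"
| Query: "computes h Query [x] (h x)"
| Comp: "list_all2 (\<lambda>c y. computes h c xs y) cs ys \<Longrightarrow> computes h c ys z
    \<Longrightarrow> computes h (Comp c cs) xs z"
| PrimRec_0: "computes h c xs y \<Longrightarrow> computes h (PrimRec c d) (0 # xs) y"
| PrimRec_Suc: "computes h (PrimRec c d) (m # xs) r \<Longrightarrow> computes h d (m # r # xs) y
    \<Longrightarrow> computes h (PrimRec c d) (Suc m # xs) y"
| Mu: "computes h c (m # xs) 0 \<Longrightarrow> (\<And>i. i < m \<Longrightarrow> \<exists>y. y \<noteq> 0 \<and> computes h c (i # xs) y)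
    \<Longrightarrow> computes h (Mu c) xs m"

lemma computes_functional:
  assumes "computes h c xs y" "computes h c xs z"
  shows "y = z"
  using assms
proof (induction arbitrary: z rule: computes.induct)
  case (Comp xs cs ys c w)
  from Comp.prems obtain ys' where
    ys': "list_all2 (\<lambda>c y. computes h c xs y) cs ys'" "computes h c ys' z"
    by (auto elim: computes.cases)
  have "ys = ys'"
    using Comp.IH(1) ys'(1) by (auto simp: list_all2_conv_all_nth intro: nth_equalityI)
  with Comp.IH(2) ys'(2) show ?case by blast
next
  case (PrimRec_0 c xs y d)
  from PrimRec_0.prems show ?case
    by cases (auto intro: PrimRec_0.IH)
next
  case (PrimRec_Suc c d m xs r y)
  from PrimRec_Suc.prems show ?case
    by cases (use PrimRec_Suc.IH in blast)
next
  case (Mu c m xs)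
  from Mu.prems obtain
    z: "computes h c (z # xs) 0" "\<And>i. i < z \<Longrightarrow> \<exists>y. y \<noteq> 0 \<and> computes h c (i # xs) y"
    by (auto elim: computes.cases)
  show ?case
  proof (rule linorder_cases[of m z])
    assume "m < z"
    with z(2) Mu.IH(1) show ?thesis by blast
  next
    assume "z < m"
    with z(1) Mu.IH(2) show ?thesis by blast
  qed
qed (auto elim: computes.cases)

definition computable_in :: "(nat \<Rightarrow> nat) \<Rightarrow> (nat \<Rightarrow> nat) \<Rightarrow> bool" where
  "computable_in h f \<longleftrightarrow> (\<exists>c. \<forall>x. computes h c [x] (f x))"

text \<open>
  Bijective binary numeration identifies finite bit strings with natural numbers. The most
  recent bit is the least significant one: if \<open>n\<close> codes \<open>xs\<close>, then \<open>2 * n + 1\<close> and \<open>2 * n + 2\<close>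
  code \<open>xs\<close> extended by \<open>False\<close> and \<open>True\<close>, respectively.
\<close>

fun bits_of :: "nat \<Rightarrow> bool list" where
  "bits_of 0 = []"
| "bits_of (Suc n) = bits_of (n div 2) @ [odd n]"

lemma bij_bits_of: "bij bits_of"
proof (rule bijI)
  show "inj bits_of"
  proof (rule injI)
    show "m = n" if "bits_of m = bits_of n" for m n
      using that
    proof (induction m arbitrary: n rule: bits_of.induct)
      case 1
      then show ?case by (cases n) auto
    next
      case (2 m)
      from "2.prems" obtain k where n: "n = Suc k" by (cases n) auto
      with 2 have "m div 2 = k div 2" "odd m = odd k" by auto
      then have "m = k" by presburger
      with n show ?case by simp
    qed
  qed
  show "surj bits_of"
  proof -
    have "\<exists>n. bits_of n = xs" for xs
    proof (induction xs rule: rev_induct)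
      case Nil
      show ?case by (rule exI[of _ 0]) simp
    next
      case (snoc b xs)
      then obtain n where n: "bits_of n = xs" by blast
      have "bits_of (Suc (2 * n + of_bool b)) = xs @ [b]"
        using n by (cases b) auto
      then show ?case by blast
    qed
    then show ?thesis unfolding surj_def by metis
  qed
qed

section \<open>The binary sequence game\<close>

text \<open>
  A strategy \<open>g\<close> of Player 2 is queried through the numbering \<^const>\<open>bits_of\<close>. The first move of
  Player 2 comes after one move of Player 1, so \<open>g []\<close> plays no role in the game.
\<close>

definition g_computable :: "(bool list \<Rightarrow> bool) \<Rightarrow> (nat \<Rightarrow> bool) \<Rightarrow> bool" where
  "g_computable g e \<longleftrightarrow> computable_in (\<lambda>n. of_bool (g (bits_of n))) (\<lambda>i. of_bool (e i))"

text \<open>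
  The moves of Player 1 are enumerated from \<open>0\<close>, so \<open>e j\<close> is the bit at position \<open>2 * j + 1\<close>.
  The play itself is indexed from \<open>1\<close>; its value at \<open>0\<close> is meaningless.
\<close>

definition play :: "(bool list \<Rightarrow> bool) \<Rightarrow> (nat \<Rightarrow> bool) \<Rightarrow> nat \<Rightarrow> bool" where
  "play g e i = (if odd i then e (i div 2) else g (map e [0..<i div 2]))"

end

theory Submission
  imports Defs
begin

text \<open>
  Player 1 plays greedily against a potential. Fix rationals \<open>2 - \<epsilon> < a < c < 2\<close> and let
  \<open>rank d\<close> be the least \<open>j\<close> with \<open>a ^ j > d\<close>. After \<open>m\<close> moves, every pair \<open>k < l \<le> 2 * m\<close>
  such that the block starting at \<open>l\<close> has so far repeated the one starting at \<open>k\<close> contributes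
  \<open>c powr - ((l - 1) div 2 + rank (l - k))\<close> to the potential. A repetition continues for at
  most one of the two next moves, since the next bit to be repeated is already known; so the
  potentials of the two continuations add up to the old one plus the weights of the new pairs,
  which are at most a constant times \<open>c powr - m\<close> because \<open>\<Sum>d. c powr - rank d\<close> is dominated by
  \<open>\<Sum>j. (a / c) ^ j\<close>. Choosing the smaller potential keeps it below a constant times
  \<open>c powr - m\<close>, as \<open>c < 2\<close>. A repetition over \<open>J\<close> moves at distance \<open>d\<close> then forces
  \<open>J \<le> rank d + M\<close> for a constant \<open>M\<close>, so \<open>d \<ge> a ^ (J - M - 1)\<close>. The potential is a finite
  sum, whence the choice is computable.
\<close>

section \<open>Closure properties of relative computability\<close>

text \<open>Codes carry no arity, so the length \<open>n\<close> is fixed here. Letting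
  \<open>f\<close> act on whole argument lists makes closure under each operation a pointwise
  statement, and computability proofs then follow the shape of a term.\<close>

definition recursive_in :: "(nat \<Rightarrow> nat) \<Rightarrow> nat \<Rightarrow> (nat list \<Rightarrow> nat) \<Rightarrow> bool" where
  "recursive_in h n f \<longleftrightarrow> (\<exists>c. \<forall>xs. length xs = n \<longrightarrow> computes h c xs (f xs))"

lemma recursive_in_cong:
  assumes "recursive_in h n f" "\<And>xs. length xs = n \<Longrightarrow> f xs = g xs"
  shows "recursive_in h n g"
  using assms unfolding recursive_in_def by metis

lemma recursive_in_comp:
  assumes F: "recursive_in h (length fs) F"
    and fs: "\<And>f. f \<in> set fs \<Longrightarrow> recursive_in h n f"
  shows "recursive_in h n (\<lambda>xs. F (map (\<lambda>f. f xs) fs))"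
proof -
  obtain c where c: "\<And>ys. length ys = length fs \<Longrightarrow> computes h c ys (F ys)"
    using F unfolding recursive_in_def by blast
  obtain k where k: "\<And>f xs. f \<in> set fs \<Longrightarrow> length xs = n \<Longrightarrow> computes h (k f) xs (f xs)"
    using fs unfolding recursive_in_def by metis
  have "computes h (Comp c (map k fs)) xs (F (map (\<lambda>f. f xs) fs))" if "length xs = n" for xs
    by (rule computes.Comp[where ys = "map (\<lambda>f. f xs) fs"])
      (auto simp: list_all2_conv_all_nth that intro: c k)
  then show ?thesis unfolding recursive_in_def by blast
qed

lemma recursive_in_hd: "recursive_in h (Suc n) hd"
  unfolding recursive_in_def
  by (rule exI[of _ "Proj 0"]) (metis computes.Proj hd_conv_nth length_greater_0_conv zero_less_Suc)

lemma recursive_in_nth: "i < n \<Longrightarrow> recursive_in h n (\<lambda>xs. xs ! i)"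
  unfolding recursive_in_def by (rule exI[of _ "Proj i"]) (auto intro: computes.Proj)

text \<open>Recursion, sums and searches put a new variable at the head of the list; this rule
  weakens a function of the old variables to the longer list.\<close>

lemma recursive_in_tl:
  assumes "recursive_in h n f"
  shows "recursive_in h (Suc n) (\<lambda>xs. f (tl xs))"
proof -
  have "recursive_in h (Suc n) (\<lambda>xs. f (map (\<lambda>g. g xs) (map (\<lambda>i xs. xs ! Suc i) [0..<n])))"
    by (rule recursive_in_comp) (auto intro: recursive_in_nth assms)
  then show ?thesis
  proof (rule recursive_in_cong)
    fix xs :: "nat list" assume "length xs = Suc n"
    then have "map (\<lambda>g. g xs) (map (\<lambda>i xs. xs ! Suc i) [0..<n]) = tl xs"
      by (auto intro!: nth_equalityI simp: nth_tl)
    then show "f (map (\<lambda>g. g xs) (map (\<lambda>i xs. xs ! Suc i) [0..<n])) = f (tl xs)" by (rule arg_cong)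
  qed
qed

lemma recursive_in_unary:
  assumes "recursive_in h 1 (\<lambda>xs. F (hd xs))" "recursive_in h n f"
  shows "recursive_in h n (\<lambda>xs. F (f xs))"
  using recursive_in_comp[of h "[f]" "\<lambda>xs. F (hd xs)" n] assms by simp

lemma recursive_in_Suc:
  assumes "recursive_in h n f"
  shows "recursive_in h n (\<lambda>xs. Suc (f xs))"
proof (rule recursive_in_unary[OF _ assms])
  have "computes h Succ xs (Suc (hd xs))" if "length xs = 1" for xs
    using that by (cases xs) (auto intro: computes.Succ)
  then show "recursive_in h 1 (\<lambda>xs. Suc (hd xs))" unfolding recursive_in_def by blast
qed

lemma recursive_in_query:
  assumes "recursive_in h n f"
  shows "recursive_in h n (\<lambda>xs. h (f xs))"
proof (rule recursive_in_unary[OF _ assms])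
  have "computes h Query xs (h (hd xs))" if "length xs = 1" for xs
    using that by (cases xs) (auto intro: computes.Query)
  then show "recursive_in h 1 (\<lambda>xs. h (hd xs))" unfolding recursive_in_def by blast
qed

lemma recursive_in_const: "recursive_in h n (\<lambda>xs. k)"
proof (induction k)
  case 0
  show ?case unfolding recursive_in_def by (auto intro: computes.Zero)
qed (rule recursive_in_Suc)

text \<open>\<open>PrimRec\<close> recurses on the head of its list and keeps the tail as
  parameters. An arbitrary recursion argument \<open>f\<close> is therefore computed first and
  placed in front of the projections.\<close>

lemma recursive_in_rec:
  assumes b: "recursive_in h n b"
    and G: "recursive_in h (Suc (Suc n)) (\<lambda>ys. G (hd ys) (hd (tl ys)) (tl (tl ys)))"
    and f: "recursive_in h n f"
  shows "recursive_in h n (\<lambda>xs. rec_nat (b xs) (\<lambda>m r. G m r xs) (f xs))"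
proof -
  obtain cb where cb: "\<And>xs. length xs = n \<Longrightarrow> computes h cb xs (b xs)"
    using b unfolding recursive_in_def by blast
  obtain cG where "\<And>ys. length ys = Suc (Suc n) \<Longrightarrow>
      computes h cG ys (G (hd ys) (hd (tl ys)) (tl (tl ys)))"
    using G unfolding recursive_in_def by blast
  from this[of "_ # _ # _"]
  have cG: "computes h cG (m # r # xs) (G m r xs)" if "length xs = n" for m r xs
    using that by simp
  have "computes h (PrimRec cb cG) (m # xs) (rec_nat (b xs) (\<lambda>m r. G m r xs) m)"
    if "length xs = n" for m xs
    by (induction m) (auto intro: computes.intros cb cG that)
  then have rec: "recursive_in h (Suc n)
      (\<lambda>ys. rec_nat (b (tl ys)) (\<lambda>m r. G m r (tl ys)) (hd ys))"
    unfolding recursive_in_def by (intro exI[of _ "PrimRec cb cG"]) (auto simp: length_Suc_conv)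
  have "recursive_in h n (\<lambda>xs. (\<lambda>ys. rec_nat (b (tl ys)) (\<lambda>m r. G m r (tl ys)) (hd ys))
      (map (\<lambda>g. g xs) (f # map (\<lambda>i xs. xs ! i) [0..<n])))"
    by (rule recursive_in_comp) (auto intro: rec f recursive_in_nth)
  then show ?thesis
  proof (rule recursive_in_cong)
    fix xs :: "nat list" assume "length xs = n"
    then have "map (\<lambda>g. g xs) (f # map (\<lambda>i xs. xs ! i) [0..<n]) = f xs # xs"
      by (auto intro!: nth_equalityI)
    then show "(\<lambda>ys. rec_nat (b (tl ys)) (\<lambda>m r. G m r (tl ys)) (hd ys))
        (map (\<lambda>g. g xs) (f # map (\<lambda>i xs. xs ! i) [0..<n]))
      = rec_nat (b xs) (\<lambda>m r. G m r xs) (f xs)" by simp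
  qed
qed

text \<open>\<open>Mu\<close> searches for a zero, so it is run on the characteristic function of
  the negation; \<open>ex\<close> makes the search terminate.\<close>

lemma recursive_in_Least:
  assumes G: "recursive_in h (Suc n) (\<lambda>ys. of_bool (\<not> P (hd ys) (tl ys)))"
    and ex: "\<And>xs. \<exists>i. P i xs"
  shows "recursive_in h n (\<lambda>xs. LEAST i. P i xs)"
proof -
  obtain c where c: "\<And>ys. length ys = Suc n \<Longrightarrow> computes h c ys (of_bool (\<not> P (hd ys) (tl ys)))"
    using G unfolding recursive_in_def by blast
  have "computes h (Mu c) xs (LEAST i. P i xs)" if len: "length xs = n" for xs
  proof (rule computes.Mu)
    have "P (LEAST i. P i xs) xs"
      using ex by (rule LeastI_ex)
    then show "computes h c ((LEAST i. P i xs) # xs) 0"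
      using c[of "(LEAST i. P i xs) # xs"] len by simp
    fix i assume "i < (LEAST i. P i xs)"
    then have "\<not> P i xs" by (rule not_less_Least)
    then show "\<exists>y. y \<noteq> 0 \<and> computes h c (i # xs) y"
      using c[of "i # xs"] len by (intro exI[of _ 1]) simp
  qed
  then show ?thesis unfolding recursive_in_def by blast
qed

section \<open>Arithmetic, decidable predicates and bounded quantification\<close>

lemma recursive_in_add:
  assumes "recursive_in h n f" "recursive_in h n g"
  shows "recursive_in h n (\<lambda>xs. f xs + g xs)"
proof -
  have "rec_nat a (\<lambda>_. Suc) b = a + b" for a b by (induction b) auto
  moreover have "recursive_in h n (\<lambda>xs. rec_nat (f xs) (\<lambda>_. Suc) (g xs))"
    by (intro recursive_in_rec recursive_in_Suc recursive_in_tl recursive_in_hd assms)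
  ultimately show ?thesis by simp
qed

lemma recursive_in_mult:
  assumes "recursive_in h n f" "recursive_in h n g"
  shows "recursive_in h n (\<lambda>xs. f xs * g xs)"
proof -
  have "rec_nat 0 (\<lambda>_ r. r + a) b = a * b" for a b :: nat by (induction b) auto
  moreover have "recursive_in h n (\<lambda>xs. rec_nat 0 (\<lambda>_ r. r + f xs) (g xs))"
    by (intro recursive_in_rec recursive_in_add recursive_in_const recursive_in_tl recursive_in_hd assms)
  ultimately show ?thesis by simp
qed

lemma recursive_in_power:
  assumes "recursive_in h n f" "recursive_in h n g"
  shows "recursive_in h n (\<lambda>xs. f xs ^ g xs)"
proof -
  have "rec_nat 1 (\<lambda>_ r. a * r) b = a ^ b" for a b :: nat by (induction b) auto
  moreover have "recursive_in h n (\<lambda>xs. rec_nat 1 (\<lambda>_ r. f xs * r) (g xs))"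
    by (intro recursive_in_rec recursive_in_mult recursive_in_const recursive_in_tl recursive_in_hd assms)
  ultimately show ?thesis by simp
qed

lemma recursive_in_diff:
  assumes "recursive_in h n f" "recursive_in h n g"
  shows "recursive_in h n (\<lambda>xs. f xs - g xs)"
proof -
  have pred: "rec_nat 0 (\<lambda>m _. m) a = a - 1" for a by (cases a) auto
  have "rec_nat a (\<lambda>_ r. rec_nat 0 (\<lambda>m _. m) r) b = a - b" for a b :: nat
    by (induction b) (auto simp: pred)
  moreover have "recursive_in h n (\<lambda>xs. rec_nat (f xs) (\<lambda>_ r. rec_nat 0 (\<lambda>m _. m) r) (g xs))"
    by (intro recursive_in_rec recursive_in_const recursive_in_tl recursive_in_hd assms)
  ultimately show ?thesis by simp
qed

lemma recursive_in_not:
  assumes "recursive_in h n (\<lambda>xs. of_bool (P xs))"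
  shows "recursive_in h n (\<lambda>xs. of_bool (\<not> P xs))"
proof -
  have "(1::nat) - of_bool p = of_bool (\<not> p)" for p by simp
  then show ?thesis
    using recursive_in_diff[OF recursive_in_const[of h n 1] assms] by simp
qed

lemma recursive_in_conj:
  assumes "recursive_in h n (\<lambda>xs. of_bool (P xs))" "recursive_in h n (\<lambda>xs. of_bool (Q xs))"
  shows "recursive_in h n (\<lambda>xs. of_bool (P xs \<and> Q xs))"
  using recursive_in_mult[OF assms] by (simp add: of_bool_conj)

lemma recursive_in_le:
  assumes "recursive_in h n f" "recursive_in h n g"
  shows "recursive_in h n (\<lambda>xs. of_bool (f xs \<le> g xs))"
proof -
  have "(1::nat) - (a - b) = of_bool (a \<le> b)" for a b :: nat by auto
  then show ?thesis
    using recursive_in_diff[OF recursive_in_const[of h n 1] recursive_in_diff[OF assms]] by simp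
qed

lemma recursive_in_less:
  assumes "recursive_in h n f" "recursive_in h n g"
  shows "recursive_in h n (\<lambda>xs. of_bool (f xs < g xs))"
  using recursive_in_not[OF recursive_in_le[OF assms(2,1)]] by (simp add: not_le)

lemma recursive_in_eq:
  assumes "recursive_in h n f" "recursive_in h n g"
  shows "recursive_in h n (\<lambda>xs. of_bool (f xs = g xs))"
  using recursive_in_conj[OF recursive_in_le[OF assms] recursive_in_le[OF assms(2,1)]]
  by (simp add: eq_iff)

lemma recursive_in_if:
  assumes "recursive_in h n (\<lambda>xs. of_bool (P xs))" "recursive_in h n f" "recursive_in h n g"
  shows "recursive_in h n (\<lambda>xs. if P xs then f xs else g xs)"
proof -
  have "(if p then a else b) = of_bool p * a + of_bool (\<not> p) * b" for p and a b :: nat by auto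
  then show ?thesis
    by (auto intro!: recursive_in_add recursive_in_mult recursive_in_not assms)
qed

lemma recursive_in_even:
  assumes "recursive_in h n f"
  shows "recursive_in h n (\<lambda>xs. of_bool (even (f xs)))"
proof -
  have "rec_nat (1::nat) (\<lambda>_ r. 1 - r) a = of_bool (even a)" for a by (induction a) auto
  moreover have "recursive_in h n (\<lambda>xs. rec_nat 1 (\<lambda>_ r. 1 - r) (f xs))"
    by (intro recursive_in_rec recursive_in_diff recursive_in_const recursive_in_tl recursive_in_hd assms)
  ultimately show ?thesis by simp
qed

lemma recursive_in_sum:
  assumes "recursive_in h (Suc n) (\<lambda>ys. F (hd ys) (tl ys))" "recursive_in h n f"
  shows "recursive_in h n (\<lambda>xs. \<Sum>i<f xs. F i xs)"
proof -
  have "rec_nat 0 (\<lambda>i r. r + F i xs) m = (\<Sum>i<m. F i xs)" for m xs by (induction m) auto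
  moreover have "recursive_in h n (\<lambda>xs. rec_nat 0 (\<lambda>i r. r + F i xs) (f xs))"
  proof (intro recursive_in_rec recursive_in_add)
    \<comment> \<open>The recursion step sees index, accumulator and parameters; the summand must
      skip the accumulator in second place.\<close>
    have "recursive_in h (Suc (Suc n)) (\<lambda>ys. (\<lambda>zs. F (hd zs) (tl zs)) (map (\<lambda>g. g ys)
        (hd # map (\<lambda>i xs. xs ! Suc (Suc i)) [0..<n])))"
      by (rule recursive_in_comp) (auto intro: recursive_in_hd recursive_in_nth assms)
    then show "recursive_in h (Suc (Suc n)) (\<lambda>ys. F (hd ys) (tl (tl ys)))"
    proof (rule recursive_in_cong)
      fix xs :: "nat list" assume "length xs = Suc (Suc n)"
      then have "map (\<lambda>g. g xs) (map (\<lambda>i xs. xs ! Suc (Suc i)) [0..<n]) = tl (tl xs)"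
        by (auto intro!: nth_equalityI simp: nth_tl)
      then show "(\<lambda>zs. F (hd zs) (tl zs)) (map (\<lambda>g. g xs)
        (hd # map (\<lambda>i xs. xs ! Suc (Suc i)) [0..<n])) = F (hd xs) (tl (tl xs))" by simp
    qed
  qed (intro recursive_in_const recursive_in_tl recursive_in_hd assms)+
  ultimately show ?thesis by simp
qed

text \<open>A bounded universal statement holds iff the number of its counterexamples is
  zero.\<close>

lemma recursive_in_all_less:
  assumes "recursive_in h (Suc n) (\<lambda>ys. of_bool (P (hd ys) (tl ys)))" "recursive_in h n f"
  shows "recursive_in h n (\<lambda>xs. of_bool (\<forall>i<f xs. P i xs))"
proof -
  have "recursive_in h n (\<lambda>xs. of_bool ((\<Sum>i<f xs. of_bool (\<not> P i xs)) = (0::nat)))"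
    by (intro recursive_in_eq recursive_in_sum recursive_in_not recursive_in_const assms)
  moreover have "((\<Sum>i<m. of_bool (\<not> P i xs)) = (0::nat)) \<longleftrightarrow> (\<forall>i<m. P i xs)" for m xs
    by (subst sum_eq_0_iff) auto
  ultimately show ?thesis by simp
qed

text \<open>Half of \<open>m\<close>, rounded down, counts the odd numbers below
  \<open>m\<close>.\<close>

lemma recursive_in_div2:
  assumes "recursive_in h n f"
  shows "recursive_in h n (\<lambda>xs. f xs div 2)"
proof -
  have "(\<Sum>i<m. of_bool (odd i)) = m div 2" for m :: nat by (induction m) auto
  moreover have "recursive_in h n (\<lambda>xs. \<Sum>i<f xs. of_bool (odd i))"
    by (intro recursive_in_sum recursive_in_not recursive_in_even recursive_in_hd assms)
  ultimately show ?thesis by simp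
qed

lemmas recursive_in_intros =
  recursive_in_query recursive_in_Suc recursive_in_add recursive_in_mult recursive_in_power
  recursive_in_diff recursive_in_not recursive_in_conj recursive_in_le recursive_in_less
  recursive_in_eq recursive_in_if recursive_in_even recursive_in_div2 recursive_in_sum
  recursive_in_all_less recursive_in_rec recursive_in_hd


section \<open>The play after finitely many moves\<close>

text \<open>A list of \<open>m\<close> moves determines the play up to position
  \<open>2 * m\<close>, because the reply there depends on these moves alone. Values further on are
  not meaningful.\<close>

definition play_of :: "(bool list \<Rightarrow> bool) \<Rightarrow> bool list \<Rightarrow> nat \<Rightarrow> bool" where
  "play_of g \<sigma> i = (if odd i then \<sigma> ! (i div 2) else g (take (i div 2) \<sigma>))"

lemma play_of_map:
  assumes "i \<le> 2 * m"
  shows "play_of g (map e [0..<m]) i = play g e i"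
proof (cases "odd i")
  case True
  then have "i div 2 < m" using assms by presburger
  then show ?thesis using True by (simp add: play_of_def play_def)
next
  case False
  moreover have "i div 2 \<le> m" using assms by simp
  ultimately show ?thesis by (simp add: play_of_def play_def take_map min_def)
qed

lemma play_of_append:
  assumes "i \<le> 2 * length \<sigma>"
  shows "play_of g (\<sigma> @ \<tau>) i = play_of g \<sigma> i"
proof (cases "odd i")
  case True
  then have "i div 2 < length \<sigma>" using assms by presburger
  then show ?thesis using True by (simp add: play_of_def nth_append)
qed (use assms in \<open>simp add: play_of_def\<close>)

lemma play_of_snoc: "play_of g (\<sigma> @ [b]) (Suc (2 * length \<sigma>)) = b"
  by (simp add: play_of_def)

text \<open>The bound on \<open>s\<close> lets the later block run over all determined positions
  from \<open>l\<close> to \<open>2 * length \<sigma>\<close>.\<close>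

definition matches :: "(bool list \<Rightarrow> bool) \<Rightarrow> bool list \<Rightarrow> nat \<Rightarrow> nat \<Rightarrow> bool" where
  "matches g \<sigma> k l \<longleftrightarrow> (\<forall>s < Suc (2 * length \<sigma>) - l. play_of g \<sigma> (k + s) = play_of g \<sigma> (l + s))"

text \<open>The new move sits at position \<open>2 * length \<sigma> + 1\<close>. The bit it has to
  repeat lies \<open>l - k\<close> places earlier, hence is already determined by
  \<open>\<sigma>\<close>: at most one value of \<open>b\<close> keeps the repetition alive.\<close>

lemma matches_snocD:
  assumes "matches g (\<sigma> @ [b]) k l" "k < l" "l \<le> 2 * length \<sigma>"
  shows "matches g \<sigma> k l" "b = play_of g \<sigma> (k + (Suc (2 * length \<sigma>) - l))"
proof -
  have *: "play_of g (\<sigma> @ [b]) (k + s) = play_of g (\<sigma> @ [b]) (l + s)"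
    if "s \<le> Suc (2 * length \<sigma>) - l" for s
    using assms(1,3) that by (simp add: matches_def)
  show "matches g \<sigma> k l"
    unfolding matches_def
  proof (intro allI impI)
    fix s assume "s < Suc (2 * length \<sigma>) - l"
    then show "play_of g \<sigma> (k + s) = play_of g \<sigma> (l + s)"
      using *[of s] assms(2,3) by (simp add: play_of_append)
  qed
  show "b = play_of g \<sigma> (k + (Suc (2 * length \<sigma>) - l))"
    using *[of "Suc (2 * length \<sigma>) - l"] assms(2,3) by (simp add: play_of_append play_of_snoc)
qed

section \<open>Reading the play off the code of a history\<close>

definition earlier :: "nat \<Rightarrow> nat \<Rightarrow> nat" where
  "earlier x r = rec_nat x (\<lambda>_ y. (y - 1) div 2) r"

text \<open>In this numeration \<open>(y - 1) div 2\<close> removes the last bit, and the code 0 of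
  the empty string is a fixed point.\<close>

lemma bits_of_earlier: "bits_of (earlier x r) = take (length (bits_of x) - r) (bits_of x)"
proof (induction r)
  case (Suc r)
  have "bits_of ((y - 1) div 2) = butlast (bits_of y)" for y by (cases y) auto
  with Suc show ?case by (simp add: earlier_def butlast_take)
qed (simp add: earlier_def)

lemma even_code_iff_last: "bits_of x \<noteq> [] \<Longrightarrow> even x \<longleftrightarrow> last (bits_of x)"
  by (cases x) auto

text \<open>The counterpart of \<open>play_of\<close> on codes, using only arithmetic and the
  oracle. A move of Player 1 is the last bit of a prefix, visible as the parity of its code; a reply
  is one query at the code of a prefix.\<close>

definition play_code :: "(nat \<Rightarrow> nat) \<Rightarrow> nat \<Rightarrow> nat \<Rightarrow> nat \<Rightarrow> nat" where
  "play_code h m x i =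
    (if odd i then of_bool (even (earlier x (m - Suc (i div 2)))) else h (earlier x (m - i div 2)))"

lemma play_code:
  assumes "i \<le> 2 * length (bits_of x)"
  shows "play_code (\<lambda>n. of_bool (g (bits_of n))) (length (bits_of x)) x i =
    of_bool (play_of g (bits_of x) i)"
proof (cases "odd i")
  case True
  let ?y = "earlier x (length (bits_of x) - Suc (i div 2))"
  have i: "i div 2 < length (bits_of x)" using True assms by presburger
  then have "bits_of ?y = take (Suc (i div 2)) (bits_of x)"
    by (simp add: bits_of_earlier)
  then have "even ?y \<longleftrightarrow> bits_of x ! (i div 2)"
    using i by (subst even_code_iff_last) (auto simp: take_Suc_conv_app_nth)
  then show ?thesis using True by (simp add: play_code_def play_of_def)
qed (use assms in \<open>simp add: play_code_def play_of_def bits_of_earlier\<close>)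

section \<open>The potential and the greedy moves\<close>

text \<open>The rationals \<open>a\<close> and \<open>c\<close> of the introduction are \<open>u / w\<close> and \<open>v / w\<close>.\<close>

locale weights =
  fixes u v w :: nat
  assumes weights: "0 < w" "w < u" "u < v" "v < 2 * w"
begin

section \<open>The rank of a distance and the total weight of all distances\<close>

definition rank :: "nat \<Rightarrow> nat" where
  "rank d = (LEAST j. d * w ^ j < u ^ j)"

lemma ex_rank: "\<exists>j. d * w ^ j < u ^ j"
proof -
  obtain j where "real d < (real u / real w) ^ j"
    using real_arch_pow[of "real u / real w" "real d"] weights by auto
  then have "real d * real w ^ j < real u ^ j"
    using weights by (simp add: power_divide field_simps)
  then have "real (d * w ^ j) < real (u ^ j)" by simp
  then show ?thesis unfolding of_nat_less_iff ..
qed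

lemma less_rank: "d * w ^ rank d < u ^ rank d"
  unfolding rank_def by (rule LeastI_ex[OF ex_rank])

lemma rank_mono: "d \<le> d' \<Longrightarrow> rank d \<le> rank d'"
  unfolding rank_def[of d]
  by (rule Least_le) (meson less_rank le_less_trans mult_le_mono1)

lemma power_le_of_rank:
  assumes "0 < d" "j < rank d"
  shows "(real u / real w) ^ j \<le> real d"
proof -
  have "u ^ j \<le> d * w ^ j"
    using assms(2) not_less_Least[of j "\<lambda>j. d * w ^ j < u ^ j"] by (simp add: rank_def)
  then have "real (u ^ j) \<le> real (d * w ^ j)" unfolding of_nat_le_iff .
  then show ?thesis using weights by (simp add: power_divide field_simps)
qed

definition \<theta> :: real where "\<theta> = real w / real v"

lemma theta: "0 < \<theta>" "\<theta> < 1" "1 < 2 * \<theta>"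
  using weights by (auto simp: \<theta>_def field_simps)

text \<open>The sum of the geometric series with ratio \<open>u / v\<close>, the quotient of the two
  rationals.\<close>

definition mass :: real where "mass = 1 / (1 - real u / real v)"

lemma mass_pos: "0 < mass"
  using weights by (simp add: mass_def)

text \<open>Fewer than \<open>(u / w) ^ j\<close> distances can have rank \<open>j\<close>, since
  each lies below that power. At weight \<open>\<theta> ^ j\<close> apiece they contribute at most
  \<open>(u / v) ^ j\<close>.\<close>

lemma sum_rank_le: "(\<Sum>d<D. \<theta> ^ rank (Suc d)) \<le> mass"
proof -
  let ?c = "real u / real v"
  have c: "0 \<le> ?c" "?c < 1" using weights by auto
  have card: "\<theta> ^ j * real (card {d. d < D \<and> Suc d * w ^ j < u ^ j}) \<le> ?c ^ j" for j
  proof -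
    have "Suc d \<le> u ^ j div w ^ j" if "Suc d * w ^ j < u ^ j" for d
      using that weights by (simp add: less_eq_div_iff_mult_less_eq)
    then have "{d. d < D \<and> Suc d * w ^ j < u ^ j} \<subseteq> {..<u ^ j div w ^ j}"
      by (auto simp: Suc_le_eq)
    then have "card {d. d < D \<and> Suc d * w ^ j < u ^ j} \<le> u ^ j div w ^ j"
      using card_mono[of "{..<u ^ j div w ^ j}"] by auto
    then have "real (card {d. d < D \<and> Suc d * w ^ j < u ^ j}) \<le> real (u ^ j div w ^ j)"
      unfolding of_nat_le_iff .
    also have "\<dots> \<le> real (u ^ j) / real (w ^ j)" by (rule of_nat_div_le_of_nat)
    finally have "\<theta> ^ j * real (card {d. d < D \<and> Suc d * w ^ j < u ^ j})
        \<le> \<theta> ^ j * (real (u ^ j) / real (w ^ j))"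
      using theta by (intro mult_left_mono) auto
    also have "\<dots> = ?c ^ j" using weights by (simp add: \<theta>_def power_divide)
    finally show ?thesis .
  qed
  \<comment> \<open>Each term is enlarged to a sum over all admissible \<open>j\<close>, one of
    which is the rank itself; by monotonicity \<open>rank D\<close> bounds all ranks
    involved.\<close>
  have "(\<Sum>d<D. \<theta> ^ rank (Suc d))
      \<le> (\<Sum>d<D. \<Sum>j<Suc (rank D). \<theta> ^ j * of_bool (Suc d * w ^ j < u ^ j))"
  proof (rule sum_mono)
    fix d assume "d \<in> {..<D}"
    then have "rank (Suc d) < Suc (rank D)" by (simp add: rank_mono less_Suc_eq_le)
    then have "\<theta> ^ rank (Suc d) * of_bool (Suc d * w ^ rank (Suc d) < u ^ rank (Suc d))
        \<le> (\<Sum>j<Suc (rank D). \<theta> ^ j * of_bool (Suc d * w ^ j < u ^ j))"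
      using theta by (intro member_le_sum) auto
    then show "\<theta> ^ rank (Suc d) \<le> (\<Sum>j<Suc (rank D). \<theta> ^ j * of_bool (Suc d * w ^ j < u ^ j))"
      using less_rank[of "Suc d"] by simp
  qed
  also have "\<dots> = (\<Sum>j<Suc (rank D). \<theta> ^ j * real (card {d. d < D \<and> Suc d * w ^ j < u ^ j}))"
    by (subst sum.swap) (simp add: sum_distrib_left[symmetric] Int_def lessThan_def)
  also have "\<dots> \<le> (\<Sum>j<Suc (rank D). ?c ^ j)" by (rule sum_mono) (rule card)
  also have "\<dots> \<le> (\<Sum>j. ?c ^ j)"
    using c by (intro sum_le_suminf summable_geometric) auto
  also have "\<dots> = mass"
    using c by (subst suminf_geometric) (auto simp: mass_def)
  finally show ?thesis .
qed

definition expo :: "nat \<Rightarrow> nat \<Rightarrow> nat" where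
  "expo k l = (l - 1) div 2 + rank (l - k)"

text \<open>Meant for \<open>l = 2 * m + 1\<close> and \<open>l = 2 * m + 2\<close>, the two
  positions filled in round \<open>m\<close>; with \<open>l\<close> fixed, the sum over
  \<open>k\<close> is a sum over distances.\<close>

lemma sum_expo_le:
  assumes "(l - 1) div 2 = m"
  shows "(\<Sum>k<l. \<theta> ^ expo k l) \<le> mass * \<theta> ^ m"
proof -
  have "(\<Sum>k<l. \<theta> ^ expo k l) = (\<Sum>k<l. \<theta> ^ rank (l - k)) * \<theta> ^ m"
    using assms by (simp add: expo_def power_add sum_distrib_left mult.commute)
  also have "(\<Sum>k<l. \<theta> ^ rank (l - k)) = (\<Sum>k<l. \<theta> ^ rank (Suc (l - Suc k)))"
    by (intro sum.cong refl) (simp add: Suc_diff_Suc)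
  also have "\<dots> = (\<Sum>d<l. \<theta> ^ rank (Suc d))"
    by (rule sum.nat_diff_reindex)
  finally show ?thesis
    using sum_rank_le[of l] theta by (simp add: mult_right_mono)
qed

section \<open>The potential and its change in one round\<close>

definition potential :: "(bool list \<Rightarrow> bool) \<Rightarrow> bool list \<Rightarrow> real" where
  "potential g \<sigma> = (\<Sum>l<Suc (2 * length \<sigma>). \<Sum>k<l. if matches g \<sigma> k l then \<theta> ^ expo k l else 0)"

lemma potential_Nil: "potential g [] = 0"
  by (simp add: potential_def)

text \<open>An old pair survives in at most one continuation. The factor 4 counts two new values of
  \<open>l\<close> in each of two continuations, every one of weight at most
  \<open>mass * \<theta> ^ length \<sigma>\<close>.\<close>

lemma potential_snoc:
  "potential g (\<sigma> @ [False]) + potential g (\<sigma> @ [True]) \<le> potential g \<sigma> + 4 * mass * \<theta> ^ length \<sigma>"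
proof -
  let ?m = "length \<sigma>"
  define S where "S b l = (\<Sum>k<l. if matches g (\<sigma> @ [b]) k l then \<theta> ^ expo k l else 0)" for b l
  have S: "S b l \<le> mass * \<theta> ^ ?m" if "(l - 1) div 2 = ?m" for b l
  proof -
    have "S b l \<le> (\<Sum>k<l. \<theta> ^ expo k l)"
      unfolding S_def using theta by (intro sum_mono) auto
    also note sum_expo_le[OF that]
    finally show ?thesis .
  qed
  have "potential g (\<sigma> @ [b]) = (\<Sum>l<Suc (2 * ?m). S b l) + S b (2 * ?m + 1) + S b (2 * ?m + 2)" for b
    by (simp add: potential_def S_def del: sum.lessThan_Suc) (simp only: sum.lessThan_Suc add_2_eq_Suc')
  then have le: "potential g (\<sigma> @ [b]) \<le> (\<Sum>l<Suc (2 * ?m). S b l) + 2 * mass * \<theta> ^ ?m" for b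
    using S[of "2 * ?m + 1" b] S[of "2 * ?m + 2" b] by simp
  have "(\<Sum>l<Suc (2 * ?m). S False l) + (\<Sum>l<Suc (2 * ?m). S True l) \<le> potential g \<sigma>"
    unfolding potential_def S_def sum.distrib[symmetric]
  proof (intro sum_mono)
    fix l k assume "l \<in> {..<Suc (2 * ?m)}" "k \<in> {..<l}"
    then show "(if matches g (\<sigma> @ [False]) k l then \<theta> ^ expo k l else 0)
        + (if matches g (\<sigma> @ [True]) k l then \<theta> ^ expo k l else 0)
      \<le> (if matches g \<sigma> k l then \<theta> ^ expo k l else 0)"
      using matches_snocD[of g \<sigma> False k l] matches_snocD[of g \<sigma> True k l] theta by auto
  qed
  then show ?thesis
    using le[of False] le[of True] by linarith
qed

text \<open>
  Scaling by a power of \<open>v\<close> whose exponent is at least every \<^term>\<open>expo k l\<close> that occurs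
  clears the denominators of the potential.
\<close>

definition potential_code :: "(nat \<Rightarrow> nat) \<Rightarrow> nat \<Rightarrow> nat \<Rightarrow> nat" where
  "potential_code h m x = (\<Sum>l<Suc (2 * m). \<Sum>k<l.
    if \<forall>s<Suc (2 * m) - l. play_code h m x (k + s) = play_code h m x (l + s)
    then w ^ expo k l * v ^ (m + rank (2 * m) - expo k l) else 0)"

lemma potential_code:
  assumes "m = length (bits_of x)"
  shows "real (potential_code (\<lambda>n. of_bool (g (bits_of n))) m x)
    = real v ^ (m + rank (2 * m)) * potential g (bits_of x)"
proof -
  let ?h = "\<lambda>n. of_bool (g (bits_of n))"
  have "real (if \<forall>s<Suc (2 * m) - l. play_code ?h m x (k + s) = play_code ?h m x (l + s)
      then w ^ expo k l * v ^ (m + rank (2 * m) - expo k l) else 0)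
    = real v ^ (m + rank (2 * m)) * (if matches g (bits_of x) k l then \<theta> ^ expo k l else 0)"
    if "k < l" "l < Suc (2 * m)" for k l
  proof -
    have "(\<forall>s<Suc (2 * m) - l. play_code ?h m x (k + s) = play_code ?h m x (l + s))
        \<longleftrightarrow> matches g (bits_of x) k l"
      unfolding matches_def assms
      by (intro all_cong) (use that assms in \<open>simp add: play_code\<close>)
    \<comment> \<open>This makes the truncated subtraction in the exponent of \<open>v\<close>
      exact.\<close>
    moreover have "expo k l \<le> m + rank (2 * m)"
      unfolding expo_def using that by (intro add_mono rank_mono) auto
    then have "real v ^ (m + rank (2 * m))
        = real v ^ expo k l * real v ^ (m + rank (2 * m) - expo k l)"
      by (simp add: power_add[symmetric])
    ultimately show ?thesis
      using weights by (simp add: \<theta>_def power_divide)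
  qed
  then show ?thesis
    unfolding potential_code_def potential_def assms[symmetric]
    by (simp add: sum_distrib_left del: sum.lessThan_Suc of_nat_mult of_nat_power)
qed

section \<open>The greedy moves and the decay of their potential\<close>

definition history :: "(nat \<Rightarrow> nat) \<Rightarrow> nat \<Rightarrow> nat" where
  "history h = rec_nat 0 (\<lambda>m x.
    if potential_code h (Suc m) (2 * x + 1) \<le> potential_code h (Suc m) (2 * x + 2)
    then 2 * x + 1 else 2 * x + 2)"

text \<open>The code of a nonempty string is even exactly when its last bit is
  \<open>True\<close>.\<close>

definition moves :: "(bool list \<Rightarrow> bool) \<Rightarrow> nat \<Rightarrow> bool" where
  "moves g i = even (history (\<lambda>n. of_bool (g (bits_of n))) (Suc i))"

lemma bits_of_history:
  "bits_of (history (\<lambda>n. of_bool (g (bits_of n))) m) = map (moves g) [0..<m]"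
proof (induction m)
  case (Suc m)
  then show ?case
    by (auto simp: moves_def history_def)
qed (simp add: history_def)

text \<open>Both candidates have length \<open>Suc m\<close>, so their integer codes carry the same
  positive factor and compare as the potentials do. The smaller of two numbers is at most their
  average.\<close>

lemma potential_moves_Suc_le:
  fixes g :: "bool list \<Rightarrow> bool"
  defines "\<sigma> \<equiv> \<lambda>m. map (moves g) [0..<m]"
  shows "2 * potential g (\<sigma> (Suc m))
    \<le> potential g (\<sigma> m @ [False]) + potential g (\<sigma> m @ [True])"
proof -
  let ?h = "\<lambda>n. of_bool (g (bits_of n))"
  let ?x = "history ?h m"
  let ?V = "real v ^ (Suc m + rank (2 * Suc m))"
  have F: "bits_of (2 * ?x + 1) = \<sigma> m @ [False]" and T: "bits_of (2 * ?x + 2) = \<sigma> m @ [True]"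
    by (simp_all add: bits_of_history \<sigma>_def)
  have 1: "real (potential_code ?h (Suc m) (2 * ?x + 1)) = ?V * potential g (\<sigma> m @ [False])"
    using potential_code[of "Suc m" "2 * ?x + 1" g] by (simp only: F) (simp add: \<sigma>_def)
  have 2: "real (potential_code ?h (Suc m) (2 * ?x + 2)) = ?V * potential g (\<sigma> m @ [True])"
    using potential_code[of "Suc m" "2 * ?x + 2" g] by (simp only: T) (simp add: \<sigma>_def)
  have V: "0 < ?V" using weights by simp
  have "potential_code ?h (Suc m) (2 * ?x + 1) \<le> potential_code ?h (Suc m) (2 * ?x + 2)
      \<longleftrightarrow> ?V * potential g (\<sigma> m @ [False]) \<le> ?V * potential g (\<sigma> m @ [True])"
    unfolding 1[symmetric] 2[symmetric] by (rule of_nat_le_iff[symmetric])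
  also have "\<dots> \<longleftrightarrow> potential g (\<sigma> m @ [False]) \<le> potential g (\<sigma> m @ [True])"
    using V by (rule mult_le_cancel_left_pos)
  finally have cmp: "potential_code ?h (Suc m) (2 * ?x + 1) \<le> potential_code ?h (Suc m) (2 * ?x + 2)
      \<longleftrightarrow> potential g (\<sigma> m @ [False]) \<le> potential g (\<sigma> m @ [True])" .
  have "\<sigma> (Suc m) = bits_of (history ?h (Suc m))"
    by (simp add: bits_of_history \<sigma>_def del: bits_of.simps)
  also have "history ?h (Suc m) = (if potential g (\<sigma> m @ [False]) \<le> potential g (\<sigma> m @ [True])
      then 2 * ?x + 1 else 2 * ?x + 2)"
    unfolding cmp[symmetric] by (simp add: history_def)
  finally have "\<sigma> (Suc m) = (if potential g (\<sigma> m @ [False]) \<le> potential g (\<sigma> m @ [True])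
      then \<sigma> m @ [False] else \<sigma> m @ [True])"
    using F T by (simp del: bits_of.simps split: if_splits)
  then show ?thesis by auto
qed

text \<open>The solution \<open>B\<close> of \<open>B + 4 * mass = 2 * \<theta> * B\<close>, which
  makes \<open>B * \<theta> ^ m\<close> reproduce itself in the recurrence; it is positive because
  \<open>1 < 2 * \<theta>\<close>.\<close>

definition bound :: real where "bound = 4 * mass / (2 * \<theta> - 1)"

lemma potential_moves_le: "potential g (map (moves g) [0..<m]) \<le> bound * \<theta> ^ m"
proof (induction m)
  case 0
  show ?case using theta mass_pos by (simp add: potential_Nil bound_def)
next
  case (Suc m)
  have "2 * potential g (map (moves g) [0..<Suc m]) \<le> bound * \<theta> ^ m + 4 * mass * \<theta> ^ m"
    using potential_moves_Suc_le[of g m] potential_snoc[of g "map (moves g) [0..<m]"] Suc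
    by simp
  also have "\<dots> = 2 * (bound * \<theta> ^ Suc m)"
    using theta by (simp add: bound_def field_simps)
  finally show ?case by simp
qed

text \<open>A surviving pair alone contributes \<open>\<theta> ^ expo k l\<close>, while the whole
  potential has decayed to \<open>bound * \<theta> ^ m\<close>; the repetition cannot outlast the
  rank by more than a constant. \<open>M\<close> depends only on the weights, which makes the final
  threshold uniform in \<open>g\<close>.\<close>

lemma matching_blocks_rank:
  "\<exists>M. \<forall>g k l J. k < l \<longrightarrow> (\<forall>s<2 * J. play g (moves g) (k + s) = play g (moves g) (l + s))
    \<longrightarrow> J \<le> M + rank (l - k)"
proof -
  have "1 < 1 / \<theta>" using theta by simp
  then obtain M where "bound < (1 / \<theta>) ^ M"
    using real_arch_pow by blast
  then have M: "bound * \<theta> ^ M < 1" using theta by (simp add: field_simps power_divide)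
  show ?thesis
  proof (intro exI[of _ M] allI impI)
    fix g k l J
    assume kl: "k < l"
      and eq: "\<forall>s<2 * J. play g (moves g) (k + s) = play g (moves g) (l + s)"
    show "J \<le> M + rank (l - k)"
    proof (rule ccontr)
      assume J: "\<not> J \<le> M + rank (l - k)"
      \<comment> \<open>Since \<open>2 * m\<close> is at most \<open>l - 1 + 2 * J\<close>, the pair
        is tested on at most \<open>2 * J\<close> bits after \<open>m\<close> moves, all covered by
        \<open>eq\<close>.\<close>
      define m where "m = (l - 1) div 2 + J"
      let ?\<sigma> = "map (moves g) [0..<m]"
      have l: "l \<le> 2 * m" using J kl unfolding m_def by presburger
      have "matches g ?\<sigma> k l"
        unfolding matches_def
      proof (intro allI impI)
        fix s assume s: "s < Suc (2 * length ?\<sigma>) - l"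
        then have "s < 2 * J" using l kl unfolding m_def by simp
        with eq s kl show "play_of g ?\<sigma> (k + s) = play_of g ?\<sigma> (l + s)"
          by (simp add: play_of_map)
      qed
      then have "\<theta> ^ expo k l \<le> (\<Sum>k<l. if matches g ?\<sigma> k l then \<theta> ^ expo k l else 0)"
        using kl theta
          member_le_sum[of k "{..<l}" "\<lambda>k. if matches g ?\<sigma> k l then \<theta> ^ expo k l else 0"] by simp
      also have "\<dots> \<le> potential g ?\<sigma>"
        unfolding potential_def using l theta by (intro member_le_sum) (auto intro!: sum_nonneg)
      also have "\<dots> \<le> bound * \<theta> ^ m" by (rule potential_moves_le)
      also have "\<theta> ^ m = \<theta> ^ expo k l * \<theta> ^ (J - rank (l - k))"
        using J by (simp add: m_def expo_def power_add[symmetric])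
      finally have "1 \<le> bound * \<theta> ^ (J - rank (l - k))"
        using theta by (simp add: field_simps)
      also have "\<dots> \<le> bound * \<theta> ^ M"
        using J theta mass_pos by (intro mult_left_mono power_decreasing) (auto simp: bound_def)
      finally show False using M by simp
    qed
  qed
qed

section \<open>Computability of the greedy moves relative to the strategy\<close>

lemma recursive_in_earlier:
  "recursive_in h n f \<Longrightarrow> recursive_in h n r \<Longrightarrow> recursive_in h n (\<lambda>xs. earlier (f xs) (r xs))"
  unfolding earlier_def
  by (intro recursive_in_intros recursive_in_const recursive_in_tl)

lemma recursive_in_play_code:
  "recursive_in h n m \<Longrightarrow> recursive_in h n f \<Longrightarrow> recursive_in h n i
    \<Longrightarrow> recursive_in h n (\<lambda>xs. play_code h (m xs) (f xs) (i xs))"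
  unfolding play_code_def
  by (intro recursive_in_intros recursive_in_earlier recursive_in_const)

lemma recursive_in_rank:
  "recursive_in h n d \<Longrightarrow> recursive_in h n (\<lambda>xs. rank (d xs))"
  unfolding rank_def
  by (intro recursive_in_Least ex_rank recursive_in_not recursive_in_less recursive_in_mult
      recursive_in_power recursive_in_hd recursive_in_const recursive_in_tl)

lemma recursive_in_expo:
  "recursive_in h n k \<Longrightarrow> recursive_in h n l \<Longrightarrow> recursive_in h n (\<lambda>xs. expo (k xs) (l xs))"
  unfolding expo_def
  by (intro recursive_in_intros recursive_in_rank recursive_in_const)

lemma recursive_in_potential_code:
  assumes "recursive_in h n m" "recursive_in h n f"
  shows "recursive_in h n (\<lambda>xs. potential_code h (m xs) (f xs))"
  unfolding potential_code_def
  by (intro recursive_in_intros recursive_in_play_code recursive_in_rank recursive_in_expo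
      recursive_in_const assms | rule recursive_in_tl)+

lemma recursive_in_history:
  assumes "recursive_in h n m"
  shows "recursive_in h n (\<lambda>xs. history h (m xs))"
  unfolding history_def
  by (intro recursive_in_intros recursive_in_potential_code recursive_in_const assms
      | rule recursive_in_tl)+

lemma g_computable_moves: "g_computable g (moves g)"
proof -
  let ?h = "\<lambda>n. of_bool (g (bits_of n)) :: nat"
  have "recursive_in ?h 1 (\<lambda>xs. of_bool (moves g (hd xs)))"
    unfolding moves_def One_nat_def
    by (intro recursive_in_intros recursive_in_history)
  then obtain c where "\<And>xs. length xs = 1 \<Longrightarrow> computes ?h c xs (of_bool (moves g (hd xs)))"
    unfolding recursive_in_def by blast
  from this[of "[_]"] have "computes ?h c [i] (of_bool (moves g i))" for i by simp
  then show ?thesis unfolding g_computable_def computable_in_def by blast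
qed

end

section \<open>Choice of the constants and conversion to the block length\<close>

theorem theorem5p8:
  fixes \<epsilon> :: real
  assumes "0 < \<epsilon>" and "\<epsilon> < 2"
  shows "\<exists>N :: nat. \<forall>g :: bool list \<Rightarrow> bool. \<exists>e :: nat \<Rightarrow> bool. g_computable g e \<and>
    (\<forall>k l n :: nat. 1 \<le> k \<and> k < l \<and> N < n \<and> (\<forall>s < n. play g e (k + s) = play g e (l + s))
      \<longrightarrow> real (l - k) \<ge> (2 - \<epsilon>) powr (real n / 2))"
proof -
  define b where "b = 2 - \<epsilon>"
  \<comment> \<open>The rationals will be \<open>2 - 2 / w\<close> and \<open>2 - 1 / w\<close>. The
    first exceeds \<open>2 - \<epsilon>\<close> once \<open>w > 2 / \<epsilon>\<close>, and exceeds
    1 once \<open>w > 2\<close>.\<close>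
  obtain w0 :: nat where "2 / \<epsilon> < real w0" using reals_Archimedean2 by blast
  define w where "w = w0 + 3"
  have w: "2 / \<epsilon> < real w" "2 < w" using \<open>2 / \<epsilon> < real w0\<close> by (auto simp: w_def)
  interpret weights "2 * w - 2" "2 * w - 1" w
    using w by unfold_locales auto
  define a where "a = real (2 * w - 2) / real w"
  have b: "0 < b" using assms by (simp add: b_def)
  have a: "b < a" "1 < a"
    using w assms by (auto simp: a_def b_def field_simps of_nat_diff)
  obtain M where M: "\<And>g k l J. k < l \<Longrightarrow>
      (\<And>s. s < 2 * J \<Longrightarrow> play g (moves g) (k + s) = play g (moves g) (l + s))
      \<Longrightarrow> J \<le> M + rank (l - k)"
    using matching_blocks_rank by blast
  \<comment> \<open>The gap between \<open>a\<close> and \<open>b\<close> pays for the constant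
    loss: \<open>a ^ (2 * M + 3)\<close> collects \<open>M\<close>, the strict inequality below the
    rank and the rounding of \<open>n / 2\<close>.\<close>
  obtain N where N: "a ^ (2 * M + 3) < (a / b) ^ N"
    using real_arch_pow[of "a / b"] a b by auto
  have "b powr (real n / 2) \<le> real (l - k)"
    if kl: "k < l" and n: "N < n"
      and eq: "\<And>s. s < n \<Longrightarrow> play g (moves g) (k + s) = play g (moves g) (l + s)" for g k l n
  proof -
    \<comment> \<open>The final 1 is subtracted to get strictly below the rank. If the subtraction
      truncates to 0, positivity of the rank still gives this.\<close>
    define i where "i = n div 2 - M - 1"
    have "n div 2 \<le> M + rank (l - k)"
      using kl by (rule M) (rule eq, simp)
    moreover have "0 < rank (l - k)"
      using less_rank[of "l - k"] kl by (cases "rank (l - k)") auto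
    ultimately have "i < rank (l - k)" by (simp add: i_def)
    then have ai: "a ^ i \<le> real (l - k)"
      unfolding a_def using kl by (intro power_le_of_rank) auto
    have "(a / b) ^ N \<le> (a / b) ^ n"
      using n a b by (intro power_increasing) auto
    with N have "a ^ (2 * M + 3) \<le> (a / b) ^ n" by (rule less_imp_le[OF less_le_trans])
    then have "b ^ n * a ^ (2 * M + 3) \<le> a ^ n"
      using b by (simp add: power_divide field_simps)
    \<comment> \<open>Here \<open>n\<close> is at most \<open>2 * (n div 2) + 1\<close>, and
      \<open>n div 2\<close> at most \<open>i + M + 1\<close>, also under truncation.\<close>
    also have "\<dots> \<le> a ^ (2 * i + (2 * M + 3))"
      using a by (intro power_increasing) (auto simp: i_def)
    also have "\<dots> = (a ^ i)\<^sup>2 * a ^ (2 * M + 3)"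
      by (simp add: power_add power_mult[symmetric] mult.commute)
    finally have "b ^ n \<le> (a ^ i)\<^sup>2"
      using a by (simp add: mult_le_cancel_right)
    moreover have "(b powr (real n / 2))\<^sup>2 = b ^ n"
      using b by (simp add: powr_power powr_realpow)
    ultimately have "(b powr (real n / 2))\<^sup>2 \<le> (a ^ i)\<^sup>2" by simp
    then have "b powr (real n / 2) \<le> a ^ i"
      by (rule power2_le_imp_le) (use a in simp)
    with ai show ?thesis by simp
  qed
  then show ?thesis
    unfolding b_def using g_computable_moves by blast
qed

end
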